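(* Let $\mathcal{R}$ be a (constructor, orthogonal) TRS having an additive DP-interpretation $\langle\!\langle-\rangle\!\rangle$ over $\mathbb{K}\in\{\mathbb{N},\mathbb{Q}^+,\mathbb{R}^+\}$. Then $\langle\!\langle-\rangle\!\rangle$ is a sup-interpretation of $\mathcal{R}$.
   Context: A constructor TRS consists of disjoint sets $\mathcal{C}$ (constructors) and $\mathcal{D}$ (defined symbols) with fixed arities, variables, and finitely many rules $l\to r$ with $l=\mathtt{f}(t_1,\dots,t_n)$, $\mathtt{f}\in\mathcal{D}$, $t_i$ built from constructors and variables, variables of $r$ occurring in $l$; throughout, TRS are orthogonal. Values are closed constructor terms; $[\![\mathtt{f}]\!](v_1,\dots,v_n)=v$ iff $\mathtt{f}(v_1,\dots,v_n)\to_\mathcal{R}^*v$ with $v$ a value, and $\mathtt{f}(v_1,\dots,v_n)\downarrow$ means such $v$ exists. An assignment over $\mathbb{K}$ maps each symbol of arity $m$ to a total function $\mathbb{K}^m\to\mathbb{K}$ and variables to variables over $\mathbb{K}$, extended homomorphically to terms; additive: each constructor $c$ of arity $n>0$ gets $X_1+\dots+X_n+k_c$, $k_c\geq1$, and $0$-ary constructors get $0$; monotonic: all functions nondecreasing in each argument. Dependency pairs: for each $\mathtt{f}\in\mathcal{D}$ introduce a fresh symbol $\mathtt{f}^\sharp$ of the same arity, and for $t=\mathtt{f}(t_1,\dots,t_n)$ write $t^\sharp=\mathtt{f}^\sharp(t_1,\dots,t_n)$. A pair $l^\sharp\to u^\sharp$ is a dependency pair if $u=\mathtt{g}(s_1,\dots,s_k)$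 with $\mathtt{g}\in\mathcal{D}$, there is a rule $l\to C[u]$ in $\mathcal{R}$ for some context $C$, and $u$ is not a proper subterm of $l$. A DP-interpretation is a monotonic assignment $\langle\!\langle-\rangle\!\rangle$, extended by $\langle\!\langle\mathtt{f}^\sharp\rangle\!\rangle=\langle\!\langle\mathtt{f}\rangle\!\rangle$, such that $\langle\!\langle l\rangle\!\rangle\geq\langle\!\langle r\rangle\!\rangle$ for every rule and $\langle\!\langle l^\sharp\rangle\!\rangle\geq\langle\!\langle u^\sharp\rangle\!\rangle$ for every dependency pair (for all variable values). A sup-interpretation is a monotonic additive assignment $\theta$ such that for all $\mathtt{f}\in\mathcal{D}$ and values $v_i$: $\mathtt{f}(v_1,\dots,v_m)\downarrow\implies\theta(\mathtt{f}(v_1,\dots,v_m))\geq\theta([\![\mathtt{f}]\!](v_1,\dots,v_m))$. *)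

theory Defs
  imports Complex_Main
begin

datatype ('f, vars: 'v) trm = Var 'v | Fun 'f "('f, 'v) trm list"

fun vars_list :: "('f, 'v) trm \<Rightarrow> 'v list" where
  "vars_list (Var x) = [x]"
| "vars_list (Fun f ts) = concat (map vars_list ts)"

fun wf_trm :: "'f set \<Rightarrow> ('f \<Rightarrow> nat) \<Rightarrow> ('f, 'v) trm \<Rightarrow> bool" where
  "wf_trm F ar (Var x) \<longleftrightarrow> True"
| "wf_trm F ar (Fun f ts) \<longleftrightarrow> f \<in> F \<and> length ts = ar f \<and> (\<forall>t\<in>set ts. wf_trm F ar t)"

fun subst :: "('v \<Rightarrow> ('f, 'w) trm) \<Rightarrow> ('f, 'v) trm \<Rightarrow> ('f, 'w) trm" where
  "subst \<sigma> (Var x) = \<sigma> x"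
| "subst \<sigma> (Fun f ts) = Fun f (map (subst \<sigma>) ts)"

datatype ('f, 'v) ctxt = Hole | More 'f "('f, 'v) trm list" "('f, 'v) ctxt" "('f, 'v) trm list"

fun plug :: "('f, 'v) ctxt \<Rightarrow> ('f, 'v) trm \<Rightarrow> ('f, 'v) trm" where
  "plug Hole t = t"
| "plug (More f ss C ts) t = Fun f (ss @ plug C t # ts)"

definition proper_subterm :: "('f, 'v) trm \<Rightarrow> ('f, 'v) trm \<Rightarrow> bool" where
  "proper_subterm u t \<longleftrightarrow> (\<exists>C. C \<noteq> Hole \<and> t = plug C u)"

record ('f, 'v) trs =
  constrs :: "'f set"
  defined :: "'f set"
  arity :: "'f \<Rightarrow> nat"
  rules :: "(('f, 'v) trm \<times> ('f, 'v) trm) set"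

definition constructor_trs :: "('f, 'v) trs \<Rightarrow> bool" where
  "constructor_trs R \<longleftrightarrow>
     constrs R \<inter> defined R = {} \<and>
     finite (rules R) \<and>
     (\<forall>(l, r)\<in>rules R.
        (\<exists>f ts. l = Fun f ts \<and> f \<in> defined R \<and> length ts = arity R f \<and>
                (\<forall>t\<in>set ts. wf_trm (constrs R) (arity R) t)) \<and>
        wf_trm (constrs R \<union> defined R) (arity R) r \<and>
        vars r \<subseteq> vars l)"

definition left_linear :: "('f, 'v) trs \<Rightarrow> bool" where
  "left_linear R \<longleftrightarrow> (\<forall>(l, r)\<in>rules R. distinct (vars_list l))"

text \<open>Using two independent substitutions replaces renaming the two rules apart. The only
  overlap tolerated is the trivial one of a rule with itself at the root.\<close>

definition non_overlapping :: "('f, 'v) trs \<Rightarrow> bool" where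
  "non_overlapping R \<longleftrightarrow>
     (\<forall>(l1, r1)\<in>rules R. \<forall>(l2, r2)\<in>rules R.
        \<forall>C u (\<sigma> :: 'v \<Rightarrow> ('f, 'v) trm) (\<tau> :: 'v \<Rightarrow> ('f, 'v) trm).
          l1 = plug C u \<longrightarrow> (\<forall>x. u \<noteq> Var x) \<longrightarrow> subst \<sigma> u = subst \<tau> l2 \<longrightarrow>
          C = Hole \<and> (l1, r1) = (l2, r2))"

definition orthogonal :: "('f, 'v) trs \<Rightarrow> bool" where
  "orthogonal R \<longleftrightarrow> left_linear R \<and> non_overlapping R"

definition rstep :: "('f, 'v) trs \<Rightarrow> (('f, 'v) trm \<times> ('f, 'v) trm) set" where
  "rstep R = {(plug C (subst \<sigma> l), plug C (subst \<sigma> r)) | C \<sigma> l r. (l, r) \<in> rules R}"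

definition is_value :: "('f, 'v) trs \<Rightarrow> ('f, 'v) trm \<Rightarrow> bool" where
  "is_value R v \<longleftrightarrow> wf_trm (constrs R) (arity R) v \<and> vars v = {}"

text \<open>The graph of the partial function computed by a defined symbol: \<open>sem R f vs v\<close> says that
  the value of \<open>f\<close> on \<open>vs\<close> is \<open>v\<close>. For orthogonal systems, which are confluent, there is at
  most one such \<open>v\<close>.\<close>

definition sem :: "('f, 'v) trs \<Rightarrow> 'f \<Rightarrow> ('f, 'v) trm list \<Rightarrow> ('f, 'v) trm \<Rightarrow> bool" where
  "sem R f vs v \<longleftrightarrow> (Fun f vs, v) \<in> (rstep R)\<^sup>* \<and> is_value R v"

definition tuples :: "real set \<Rightarrow> nat \<Rightarrow> real list set" where
  "tuples K n = {xs. length xs = n \<and> set xs \<subseteq> K}"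

text \<open>The domain of an assignment is a set \<open>K\<close> of reals. The function attached to a symbol is
  only relevant on tuples over \<open>K\<close> whose length is the arity of the symbol.\<close>

definition assignment :: "real set \<Rightarrow> ('f, 'v) trs \<Rightarrow> ('f \<Rightarrow> real list \<Rightarrow> real) \<Rightarrow> bool" where
  "assignment K R A \<longleftrightarrow>
     (\<forall>f\<in>constrs R \<union> defined R. \<forall>xs\<in>tuples K (arity R f). A f xs \<in> K)"

fun interp :: "('f \<Rightarrow> real list \<Rightarrow> real) \<Rightarrow> ('v \<Rightarrow> real) \<Rightarrow> ('f, 'v) trm \<Rightarrow> real" where
  "interp A \<alpha> (Var x) = \<alpha> x"
| "interp A \<alpha> (Fun f ts) = A f (map (interp A \<alpha>) ts)"

definition interp_ge ::
  "real set \<Rightarrow> ('f \<Rightarrow> real list \<Rightarrow> real) \<Rightarrow> ('f, 'v) trm \<Rightarrow> ('f, 'v) trm \<Rightarrow> bool" where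
  "interp_ge K A s t \<longleftrightarrow> (\<forall>\<alpha>. range \<alpha> \<subseteq> K \<longrightarrow> interp A \<alpha> s \<ge> interp A \<alpha> t)"

definition additive_on :: "real set \<Rightarrow> ('f, 'v) trs \<Rightarrow> ('f \<Rightarrow> real list \<Rightarrow> real) \<Rightarrow> bool" where
  "additive_on K R A \<longleftrightarrow>
     (\<forall>c\<in>constrs R.
        (arity R c = 0 \<longrightarrow> A c [] = 0) \<and>
        (arity R c > 0 \<longrightarrow>
           (\<exists>k\<in>K. k \<ge> 1 \<and> (\<forall>xs\<in>tuples K (arity R c). A c xs = sum_list xs + k))))"

definition monotonic :: "real set \<Rightarrow> ('f, 'v) trs \<Rightarrow> ('f \<Rightarrow> real list \<Rightarrow> real) \<Rightarrow> bool" where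
  "monotonic K R A \<longleftrightarrow>
     (\<forall>f\<in>constrs R \<union> defined R. \<forall>xs\<in>tuples K (arity R f). \<forall>i<arity R f. \<forall>y\<in>K.
        xs ! i \<le> y \<longrightarrow> A f xs \<le> A f (xs[i := y]))"

datatype 'f marked = Base 'f | Sharp 'f

fun sharp :: "('f, 'v) trm \<Rightarrow> ('f marked, 'v) trm" where
  "sharp (Fun f ts) = Fun (Sharp f) (map (map_trm Base (\<lambda>x. x)) ts)"
| "sharp (Var x) = Var x"

fun extend_marked :: "('f \<Rightarrow> real list \<Rightarrow> real) \<Rightarrow> 'f marked \<Rightarrow> real list \<Rightarrow> real" where
  "extend_marked A (Base f) = A f"
| "extend_marked A (Sharp f) = A f"

definition dependency_pairs ::
  "('f, 'v) trs \<Rightarrow> (('f marked, 'v) trm \<times> ('f marked, 'v) trm) set" where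
  "dependency_pairs R =
     {(sharp l, sharp u) | l u.
        (\<exists>g ss. u = Fun g ss \<and> g \<in> defined R) \<and>
        (\<exists>C. (l, plug C u) \<in> rules R) \<and>
        \<not> proper_subterm u l}"

definition dp_interpretation ::
  "real set \<Rightarrow> ('f, 'v) trs \<Rightarrow> ('f \<Rightarrow> real list \<Rightarrow> real) \<Rightarrow> bool" where
  "dp_interpretation K R A \<longleftrightarrow>
     assignment K R A \<and> monotonic K R A \<and>
     (\<forall>(l, r)\<in>rules R. interp_ge K A l r) \<and>
     (\<forall>(s, t)\<in>dependency_pairs R. interp_ge K (extend_marked A) s t)"

definition sup_interpretation ::
  "real set \<Rightarrow> ('f, 'v) trs \<Rightarrow> ('f \<Rightarrow> real list \<Rightarrow> real) \<Rightarrow> bool" where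
  "sup_interpretation K R \<theta> \<longleftrightarrow>
     assignment K R \<theta> \<and> monotonic K R \<theta> \<and> additive_on K R \<theta> \<and>
     (\<forall>f\<in>defined R. \<forall>vs v.
        length vs = arity R f \<longrightarrow> (\<forall>w\<in>set vs. is_value R w) \<longrightarrow> sem R f vs v \<longrightarrow>
        interp_ge K \<theta> (Fun f vs) v)"

end

theory Submission
  imports Defs
begin

text \<open>Monotonicity and \<open>interp l \<ge> interp r\<close> for every rule make the interpretation
  non-increasing along rewriting of well-formed terms. A reduction from \<open>f(v\<^sub>1, \<dots>, v\<^sub>n)\<close> to a
  value therefore cannot increase it.\<close>

text \<open>This moves a substitution into the valuation, so that a rule inequality, which ranges
  over valuations, applies to every instance of the rule.\<close>

lemma interp_subst: "interp A \<alpha> (subst \<sigma> t) = interp A (\<lambda>x. interp A \<alpha> (\<sigma> x)) t"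
  by (induction t) (auto simp: comp_def cong: map_cong)

text \<open>This allows a valuation to be altered outside the variables of a rule in order to keep
  its range inside \<open>K\<close>.\<close>

lemma interp_cong_vars: "(\<And>x. x \<in> vars t \<Longrightarrow> \<alpha> x = \<beta> x) \<Longrightarrow> interp A \<alpha> t = interp A \<beta> t"
proof (induction t)
  case (Fun f ts)
  then have "map (interp A \<alpha>) ts = map (interp A \<beta>) ts"
    by auto
  then show ?case
    by (simp only: interp.simps)
qed simp

lemma wf_trm_mono: "wf_trm F ar t \<Longrightarrow> F \<subseteq> G \<Longrightarrow> wf_trm G ar t"
  by (induction t) auto

lemma wf_trm_subst:
  "wf_trm F ar t \<Longrightarrow> (\<And>x. x \<in> vars t \<Longrightarrow> wf_trm F ar (\<sigma> x)) \<Longrightarrow> wf_trm F ar (subst \<sigma> t)"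
  by (induction t) auto

lemma wf_trm_substD: "wf_trm F ar (subst \<sigma> t) \<Longrightarrow> x \<in> vars t \<Longrightarrow> wf_trm F ar (\<sigma> x)"
  by (induction t) auto

lemma wf_trm_plugD: "wf_trm F ar (plug C t) \<Longrightarrow> wf_trm F ar t"
  by (induction C) auto

lemma wf_trm_plug_replace:
  "wf_trm F ar (plug C s) \<Longrightarrow> wf_trm F ar t \<Longrightarrow> wf_trm F ar (plug C t)"
  by (induction C) auto

text \<open>\<open>monotonic\<close> and \<open>interp_ge\<close> constrain only arguments from
  \<open>K\<close>. This lemma supplies membership in \<open>K\<close>, which is why well-formedness
  is tracked throughout the argument.\<close>

lemma interp_in_carrier:
  assumes "assignment K R A" and "range \<alpha> \<subseteq> K" and "wf_trm (constrs R \<union> defined R) (arity R) t"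
  shows "interp A \<alpha> t \<in> K"
  using assms(3)
proof (induction t)
  case (Var x)
  then show ?case using assms(2) by auto
next
  case (Fun f ts)
  then have "map (interp A \<alpha>) ts \<in> tuples K (arity R f)"
    by (auto simp: tuples_def)
  with Fun.prems show ?case
    using assms(1) by (auto simp: assignment_def)
qed

text \<open>Induction on the context: each layer changes a single argument, which is the form in
  which \<open>monotonic\<close> is stated.\<close>

lemma interp_plug_mono:
  assumes "assignment K R A" and "monotonic K R A" and "range \<alpha> \<subseteq> K"
    and "wf_trm (constrs R \<union> defined R) (arity R) (plug C s)"
    and "wf_trm (constrs R \<union> defined R) (arity R) t"
    and "interp A \<alpha> t \<le> interp A \<alpha> s"
  shows "interp A \<alpha> (plug C t) \<le> interp A \<alpha> (plug C s)"
  using assms(4)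
proof (induction C)
  case Hole
  then show ?case using assms(6) by simp
next
  case (More f ss C ts)
  \<comment> \<open>These are the arguments on the smaller side. The hole sits at index
    \<open>length ss\<close>, and overwriting that entry with the interpretation of
    \<open>plug C s\<close> gives the arguments on the larger side.\<close>
  let ?xs = "map (interp A \<alpha>) ss @ interp A \<alpha> (plug C t) # map (interp A \<alpha>) ts"
  have wfs: "wf_trm (constrs R \<union> defined R) (arity R) (plug C s)"
    using More.prems by auto
  then have wft: "wf_trm (constrs R \<union> defined R) (arity R) (plug C t)"
    using assms(5) wf_trm_plug_replace by blast
  have "?xs \<in> tuples K (arity R f)"
    using More.prems interp_in_carrier[OF assms(1,3)] wft by (auto simp: tuples_def)
  moreover have "f \<in> constrs R \<union> defined R" "length ss < arity R f"
    using More.prems by auto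
  moreover have "?xs ! length ss \<le> interp A \<alpha> (plug C s)"
    using More.IH[OF wfs] by (simp add: nth_append)
  ultimately have "A f ?xs \<le> A f (?xs[length ss := interp A \<alpha> (plug C s)])"
    using assms(2) interp_in_carrier[OF assms(1,3) wfs] by (simp only: monotonic_def)
  then show ?case
    by (simp add: list_update_append)
qed

text \<open>The rule inequality, instantiated at the redex, is lifted through the context by
  monotonicity. Well-formedness of \<open>t\<close> is part of the conclusion so that steps can be
  chained.\<close>

lemma rstep_interp_le:
  assumes "constructor_trs R" and "assignment K R A" and "monotonic K R A"
    and "\<forall>(l, r)\<in>rules R. interp_ge K A l r" and "range \<alpha> \<subseteq> K"
    and "(s, t) \<in> rstep R" and "wf_trm (constrs R \<union> defined R) (arity R) s"
  shows "wf_trm (constrs R \<union> defined R) (arity R) t \<and> interp A \<alpha> t \<le> interp A \<alpha> s"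
proof -
  let ?wf = "wf_trm (constrs R \<union> defined R) (arity R)"
  obtain C \<sigma> l r where s: "s = plug C (subst \<sigma> l)" and t: "t = plug C (subst \<sigma> r)"
    and lr: "(l, r) \<in> rules R"
    using assms(6) by (auto simp: rstep_def)
  have wfr: "?wf r" and vars: "vars r \<subseteq> vars l"
    using assms(1) lr by (auto simp: constructor_trs_def)
  \<comment> \<open>The redex is a subterm of the well-formed \<open>s\<close>, and each
    \<open>\<sigma> x\<close> with \<open>x\<close> in \<open>l\<close> is a subterm of the
    redex.\<close>
  have wf\<sigma>: "?wf (\<sigma> x)" if "x \<in> vars l" for x
    using assms(7) that wf_trm_plugD wf_trm_substD unfolding s by metis
  have wf\<sigma>r: "?wf (subst \<sigma> r)"
    using wfr vars wf\<sigma> by (auto intro: wf_trm_subst)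
  \<comment> \<open>\<open>\<sigma>\<close> may send variables outside \<open>l\<close> to ill-formed terms, whose interpretation need not
    lie in \<open>K\<close>.\<close>
  define \<beta> where "\<beta> x = (if x \<in> vars l then interp A \<alpha> (\<sigma> x) else \<alpha> x)" for x
  have "range \<beta> \<subseteq> K"
    using assms(5) interp_in_carrier[OF assms(2,5) wf\<sigma>] by (auto simp: \<beta>_def)
  then have "interp A \<beta> r \<le> interp A \<beta> l"
    using assms(4) lr by (auto simp: interp_ge_def)
  \<comment> \<open>\<open>\<beta>\<close> agrees on \<open>vars l\<close>, hence on
    \<open>vars r\<close>, with the valuation that \<open>interp_subst\<close> produces.\<close>
  moreover have "interp A \<alpha> (subst \<sigma> l) = interp A \<beta> l" "interp A \<alpha> (subst \<sigma> r) = interp A \<beta> r"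
    unfolding interp_subst using vars by (auto simp: \<beta>_def intro!: interp_cong_vars)
  ultimately show ?thesis
    using assms(7) wf\<sigma>r wf_trm_plug_replace interp_plug_mono[OF assms(2,3,5)]
    unfolding s t by metis
qed

lemma rsteps_interp_le:
  assumes "constructor_trs R" and "assignment K R A" and "monotonic K R A"
    and "\<forall>(l, r)\<in>rules R. interp_ge K A l r" and "range \<alpha> \<subseteq> K"
    and "(s, t) \<in> (rstep R)\<^sup>*" and "wf_trm (constrs R \<union> defined R) (arity R) s"
  shows "wf_trm (constrs R \<union> defined R) (arity R) t \<and> interp A \<alpha> t \<le> interp A \<alpha> s"
  using assms(6)
proof (induction rule: rtrancl_induct)
  case base
  then show ?case using assms(7) by simp
next
  case (step t u)
  then show ?case using rstep_interp_le[OF assms(1-5), of t u] by auto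
qed

theorem theorem24:
  fixes R :: "('f, 'v) trs" and K :: "real set" and A :: "'f \<Rightarrow> real list \<Rightarrow> real"
  assumes "constructor_trs R" and "orthogonal R"
    and "K \<in> {\<nat>, {q \<in> \<rat>. q \<ge> 0}, {r. r \<ge> 0}}"
    and "dp_interpretation K R A" and "additive_on K R A"
  shows "sup_interpretation K R A"
proof -
  have dp: "assignment K R A" "monotonic K R A" "\<forall>(l, r)\<in>rules R. interp_ge K A l r"
    using assms(4) by (auto simp: dp_interpretation_def)
  \<comment> \<open>The other three components of a sup-interpretation are among the hypotheses, so
    only the bound on computed values has to be shown.\<close>
  have "interp_ge K A (Fun f vs) v"
    if "f \<in> defined R" "length vs = arity R f" "\<forall>w\<in>set vs. is_value R w" "sem R f vs v"
    for f and vs :: "('f, 'v) trm list" and v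
  proof -
    \<comment> \<open>Values are well-formed over the constructors alone, hence over the full
      signature, so the reduction starts from a well-formed term.\<close>
    have "wf_trm (constrs R \<union> defined R) (arity R) (Fun f vs)"
      using that(1-3) by (auto simp: is_value_def intro: wf_trm_mono)
    moreover have "(Fun f vs, v) \<in> (rstep R)\<^sup>*"
      using that(4) by (simp add: sem_def)
    ultimately show ?thesis
      using rsteps_interp_le[OF assms(1) dp] unfolding interp_ge_def by blast
  qed
  then show ?thesis
    using dp(1,2) assms(5) by (simp add: sup_interpretation_def)
qed

end
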